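(* Suppose $F$ satisfies Assumption A1, $F\in MDA(\Lambda)$ (i.e. $\xi=0$), Assumption A3, and $x_F<\infty$. Let $Y=1/(x_F-X)$ with distribution function $F_Y$, $\bar F_Y=1-F_Y$, and density $f_Y$. Then there exists $z_Y<\infty$ such that on $(z_Y,\infty)$, $F_Y$ is twice differentiable and $f_Y$ is positive, decreasing and convex. Moreover, $F_Y\in MDA(\Lambda)$ with infinite right endpoint, and $$\lim_{x\to\infty}\frac{\bar F_Y(x)f_Y'(x)}{f_Y(x)^2}=-1.$$
   Context: $X$ is a continuous random variable with distribution function $F$, density $f$, $\bar F=1-F$, and right endpoint $x_F=\sup\{x:F(x)<1\}$. For $\xi\in\mathbb{R}$, $H_\xi(x)=\exp\{-(1+\xi x)^{-1/\xi}\}$ if $\xi\ne0$ and $H_0(x)=\Lambda(x)=\exp\{-e^{-x}\}$, for $1+\xi x>0$. $F\in MDA(H_\xi)$ means there exist $c_n>0$, $d_n\in\mathbb{R}$ with $c_n^{-1}(M_n-d_n)$ converging in distribution to $H_\xi$, $M_n$ the maximum of $n$ i.i.d. copies of $X$. Assumption A1: there exists $z<x_F$ such that on $(z,x_F)$, $F$ is twice differentiable and $f$ is positive, decreasing and convex. Assumption A3: $\lim_{x\uparrow x_F}\bar F(x)f'(x)/f(x)^2=-1$. *)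

theory Defs
  imports "HOL-Probability.Probability"
begin

definition Gumbel :: "real \<Rightarrow> real" where
  "Gumbel x = exp (- exp (- x))"

text \<open>Maximum domain of attraction: F in MDA(H) iff there are c_n > 0 and d_n such that
  (M_n - d_n)/c_n converges in distribution to H. Since the maximum of n iid copies
  of X has distribution function F^n, P((M_n - d_n)/c_n \<le> x) = F(c_n x + d_n)^n, and
  convergence in distribution means convergence at every continuity point of H.\<close>
definition MDA :: "(real \<Rightarrow> real) \<Rightarrow> (real \<Rightarrow> real) \<Rightarrow> bool" where
  "MDA H F \<longleftrightarrow> (\<exists>c d :: nat \<Rightarrow> real. (\<forall>n. c n > 0) \<and>
      (\<forall>x. isCont H x \<longrightarrow> (\<lambda>n. F (c n * x + d n) ^ n) \<longlonglongrightarrow> H x))"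

definition right_endpoint :: "(real \<Rightarrow> real) \<Rightarrow> ereal" where
  "right_endpoint F = Sup (ereal ` {x. F x < 1})"

end

theory Submission
  imports Defs "HOL-Real_Asymp.Real_Asymp"
begin

text \<open>
  Substituting x = xF - 1/y, the variable Y = 1/(xF - X) has density fY(y) = f(xF - 1/y) / y^2 for
  y > 0. Since y \<mapsto> xF - 1/y is increasing and concave and y \<mapsto> 1/y^2 is decreasing and convex,
  positivity, monotonicity and convexity of f pass to fY. Differentiating fY gives, at x = xF - 1/y,
    (1 - FY) fY' / fY^2 = (1 - F) f' / f^2 - 2 (1 - F(x)) / ((xF - x) f(x)).
  By A3 the auxiliary function (1 - F)/f has derivative tending to 0 at xF; as 1 - F vanishes at xF
  this forces (1 - F)/f \<rightarrow> 0, and L'Hopital then makes the last quotient tend to 0. So Y satisfies A3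
  at infinity. That is von Mises' condition: with G = (1 - FY)/fY and b_n the point where 1 - FY
  equals 1/n, the ratio (1 - FY)(b_n + G(b_n) x) / (1 - FY)(b_n) tends to e^(-x), hence
  FY(b_n + G(b_n) x)^n tends to the Gumbel distribution function.
\<close>

section \<open>Von Mises' criterion for the Gumbel domain of attraction\<close>

lemma abs_diff_le_if_deriv_bounded:
  fixes G G' :: "real \<Rightarrow> real"
  assumes "\<And>s. s \<in> {a..b} \<Longrightarrow> (G has_real_derivative G' s) (at s)"
    and "\<And>s. s \<in> {a..b} \<Longrightarrow> \<bar>G' s\<bar> \<le> e" and "x \<in> {a..b}" "y \<in> {a..b}"
  shows "\<bar>G x - G y\<bar> \<le> e * \<bar>x - y\<bar>"
  using field_differentiable_bound[of "{a..b}" G G' e x y] assms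
  by (auto simp: has_field_derivative_at_within)

lemma tendsto_one_minus_power:
  fixes t :: "nat \<Rightarrow> real"
  assumes lim: "(\<lambda>n. real n * t n) \<longlonglongrightarrow> L"
  shows "(\<lambda>n. (1 - t n) ^ n) \<longlonglongrightarrow> exp (- L)"
proof -
  define q where "q s = (if s = 0 then -1 else ln (1 - s) / s)" for s :: real
  have "((\<lambda>s::real. ln (1 - s)) has_real_derivative -1) (at 0)"
    by (auto intro!: derivative_eq_intros)
  then have "((\<lambda>s::real. ln (1 - s) / s) \<longlongrightarrow> -1) (at 0)"
    unfolding has_field_derivative_iff by simp
  moreover have "eventually (\<lambda>s. ln (1 - s) / s = q s) (at 0)"
    by (simp add: eventually_at_filter q_def)
  ultimately have "(q \<longlongrightarrow> -1) (at 0)"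
    by (rule Lim_transform_eventually)
  then have "isCont q 0"
    by (simp add: isCont_def q_def)
  have t0: "t \<longlonglongrightarrow> 0"
  proof -
    have "(\<lambda>n. real n * t n * (1 / real n)) \<longlonglongrightarrow> L * 0"
      by (intro tendsto_mult lim lim_inverse_n')
    moreover have "eventually (\<lambda>n. real n * t n * (1 / real n) = t n) sequentially"
      using eventually_gt_at_top[of "0::nat"] by eventually_elim simp
    ultimately show ?thesis by (simp add: tendsto_cong)
  qed
  have "(\<lambda>n. exp (real n * t n * q (t n))) \<longlonglongrightarrow> exp (L * q 0)"
    by (intro tendsto_intros lim isCont_tendsto_compose[OF \<open>isCont q 0\<close> t0])
  moreover have "eventually (\<lambda>n. exp (real n * t n * q (t n)) = (1 - t n) ^ n) sequentially"
    using order_tendstoD(2)[OF t0 zero_less_one]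
    by eventually_elim (auto simp: q_def exp_of_nat_mult[symmetric] ln_realpow[symmetric])
  ultimately show ?thesis by (simp add: q_def tendsto_cong)
qed

lemma survival_ratio_tendsto_exp:
  fixes Hb h G' :: "real \<Rightarrow> real" and z0 x :: real
  assumes Hb_deriv: "\<And>y. y > z0 \<Longrightarrow> (Hb has_real_derivative - h y) (at y)"
    and Hb_pos: "\<And>y. Hb y > 0" and h_pos: "\<And>y. y > z0 \<Longrightarrow> h y > 0"
    and G_deriv: "\<And>y. y > z0 \<Longrightarrow> ((\<lambda>y. Hb y / h y) has_real_derivative G' y) (at y)"
    and G'_lim: "(G' \<longlongrightarrow> 0) at_top"
  shows "((\<lambda>b. Hb (b + Hb b / h b * x) / Hb b) \<longlongrightarrow> exp (- x)) at_top"
proof -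
  define G where "G y = Hb y / h y" for y
  have G_pos: "G y > 0" if "y > z0" for y using Hb_pos[of y] h_pos[OF that] by (simp add: G_def)
  have "((\<lambda>b. ln (Hb (b + G b * x)) - ln (Hb b)) \<longlongrightarrow> - x) at_top"
  proof (rule tendstoI)
    fix \<epsilon> :: real assume "\<epsilon> > 0"
    define e where "e = min (1 / (2 * (\<bar>x\<bar> + 1))) (\<epsilon> / (2 * (x\<^sup>2 + 1)))"
    have "e > 0" using \<open>\<epsilon> > 0\<close> by (simp add: e_def add_nonneg_pos)
    have ex: "\<bar>x\<bar> * e \<le> 1/2"
    proof -
      have "\<bar>x\<bar> * e \<le> \<bar>x\<bar> * (1 / (2 * (\<bar>x\<bar> + 1)))" by (intro mult_left_mono) (auto simp: e_def)
      also have "\<dots> \<le> 1/2" by (simp add: field_simps)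
      finally show ?thesis .
    qed
    have ex2: "2 * e * x\<^sup>2 < \<epsilon>"
    proof -
      have "2 * e * x\<^sup>2 \<le> 2 * (\<epsilon> / (2 * (x\<^sup>2 + 1))) * x\<^sup>2"
        by (intro mult_right_mono mult_left_mono) (auto simp: e_def)
      also have "\<dots> = \<epsilon> * (x\<^sup>2 / (x\<^sup>2 + 1))"
        using add_nonneg_pos[of "x\<^sup>2" 1] by (simp add: field_simps)
      also have "\<dots> < \<epsilon>"
        using \<open>\<epsilon> > 0\<close> add_nonneg_pos[of "x\<^sup>2" 1] by (simp add: mult_less_cancel_left1 divide_less_eq)
      finally show ?thesis .
    qed
    obtain B where "B > z0" and B: "\<And>s. s \<ge> B \<Longrightarrow> \<bar>G' s\<bar> \<le> e"
    proof -
      obtain N where "\<forall>s\<ge>N. dist (G' s) 0 < e"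
        using tendstoD[OF G'_lim \<open>e > 0\<close>] by (auto simp: eventually_at_top_linorder)
      then show thesis by (intro that[of "max N (z0 + 1)"]) auto
    qed
    have G_lip: "\<bar>G s - G t\<bar> \<le> e * \<bar>s - t\<bar>" if "s \<ge> B" "t \<ge> B" for s t
      using abs_diff_le_if_deriv_bounded[of B "max s t" G G' e s t] G_deriv B \<open>B > z0\<close> that
      by (auto simp: G_def[abs_def])
    have "eventually (\<lambda>b. b \<ge> B + 2 * (\<bar>x\<bar> * G B)) at_top" by simp
    then show "eventually (\<lambda>b. dist (ln (Hb (b + G b * x)) - ln (Hb b)) (- x) < \<epsilon>) at_top"
    proof eventually_elim
      case (elim b)
      have "0 \<le> \<bar>x\<bar> * G B" using G_pos[OF \<open>B > z0\<close>] by simp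
      then have "b \<ge> B" using elim by linarith
      have "G b > 0" using G_pos \<open>b \<ge> B\<close> \<open>B > z0\<close> by simp
      define c where "c = b + G b * x"
      have "\<bar>x\<bar> * G b \<le> \<bar>x\<bar> * (G B + e * (b - B))"
        using G_lip[OF \<open>b \<ge> B\<close>, of B] \<open>b \<ge> B\<close> by (intro mult_left_mono) auto
      also have "\<dots> = \<bar>x\<bar> * G B + (\<bar>x\<bar> * e) * (b - B)" by (simp add: algebra_simps)
      also have "\<dots> \<le> \<bar>x\<bar> * G B + 1/2 * (b - B)"
        using ex \<open>b \<ge> B\<close> by (intro add_left_mono mult_right_mono) auto
      finally have "\<bar>x\<bar> * G b \<le> \<bar>x\<bar> * G B + 1/2 * (b - B)" .
      moreover have cb: "\<bar>c - b\<bar> = \<bar>x\<bar> * G b" using \<open>G b > 0\<close> by (simp add: c_def abs_mult)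
      ultimately have "\<bar>c - b\<bar> \<le> b - B" using elim by argo
      then have I: "{min b c..max b c} \<subseteq> {B..}" by auto
      have G_near: "\<bar>G s - G b\<bar> \<le> e * (\<bar>x\<bar> * G b)" "G s \<ge> G b / 2"
        if "s \<in> {min b c..max b c}" for s
      proof -
        have "\<bar>G s - G b\<bar> \<le> e * \<bar>s - b\<bar>" using G_lip that I \<open>b \<ge> B\<close> by auto
        also have "\<dots> \<le> e * \<bar>c - b\<bar>"
          using that \<open>e > 0\<close> by (intro mult_left_mono) (auto simp: min_def max_def split: if_splits)
        finally show 1: "\<bar>G s - G b\<bar> \<le> e * (\<bar>x\<bar> * G b)" by (simp only: cb)
        have "e * (\<bar>x\<bar> * G b) \<le> G b / 2"
          using mult_right_mono[OF ex, of "G b"] \<open>G b > 0\<close> by (simp add: mult_ac)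
        with 1 show "G s \<ge> G b / 2" by linarith
      qed
      \<comment> \<open>On the segment from b to c, ln Hb has slope -1/G, which is 1/G(b) up to a relative error of order e.\<close>
      define w where "w s = ln (Hb s) + (s - b) / G b" for s
      define w' where "w' s = 1 / G b - 1 / G s" for s
      have w_deriv: "(w has_real_derivative w' s) (at s)" if "s \<in> {min b c..max b c}" for s
      proof -
        have "s > z0" using that I \<open>B > z0\<close> by auto
        then show ?thesis unfolding w_def[abs_def] w'_def using Hb_pos[of s] Hb_pos[of b] h_pos[of s] h_pos[of b] \<open>b \<ge> B\<close> \<open>B > z0\<close>
          by (auto intro!: derivative_eq_intros Hb_deriv simp: G_def field_simps)
      qed
      have w'_bound: "\<bar>w' s\<bar> \<le> 2 * e * \<bar>x\<bar> / G b" if "s \<in> {min b c..max b c}" for s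
      proof -
        have "\<bar>w' s\<bar> = \<bar>G s - G b\<bar> / (G s * G b)"
          using G_near(2)[OF that] \<open>G b > 0\<close> by (simp add: w'_def field_simps abs_div)
        also have "\<dots> \<le> (e * (\<bar>x\<bar> * G b)) / (G b / 2 * G b)"
          using G_near[OF that] \<open>G b > 0\<close> by (intro frac_le mult_right_mono) auto
        also have "\<dots> = 2 * e * \<bar>x\<bar> / G b" using \<open>G b > 0\<close> by (simp add: field_simps)
        finally show ?thesis .
      qed
      have "\<bar>w c - w b\<bar> \<le> 2 * e * \<bar>x\<bar> / G b * \<bar>c - b\<bar>"
        by (rule abs_diff_le_if_deriv_bounded[OF w_deriv w'_bound]) auto
      also have "\<dots> = 2 * e * x\<^sup>2" using \<open>G b > 0\<close> cb by (simp add: power2_eq_square field_simps)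
      finally have "\<bar>w c - w b\<bar> < \<epsilon>" using ex2 by simp
      moreover have "w c - w b = ln (Hb (b + G b * x)) - ln (Hb b) - (- x)"
        using \<open>G b > 0\<close> by (simp add: w_def c_def)
      ultimately show ?case by (simp add: dist_real_def)
    qed
  qed
  then have "((\<lambda>b. exp (ln (Hb (b + G b * x)) - ln (Hb b))) \<longlongrightarrow> exp (- x)) at_top"
    by (rule tendsto_exp)
  then show ?thesis using Hb_pos by (simp add: exp_diff G_def)
qed

lemma survival_quantile_sequence:
  fixes Hb :: "real \<Rightarrow> real"
  assumes anti: "antimono Hb" and pos: "\<And>y. Hb y > 0" and lim: "(Hb \<longlongrightarrow> 0) at_top"
    and cont: "\<And>y. y \<ge> a \<Longrightarrow> isCont Hb y"
  obtains b :: "nat \<Rightarrow> real" where "\<And>n. b n \<ge> a" "filterlim b at_top sequentially"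
    "eventually (\<lambda>n. Hb (b n) = 1 / real n) sequentially"
proof -
  have level: "\<exists>y\<ge>a. Hb y = 1 / real n" if "1 / real n \<le> Hb a" "n > 0" for n
  proof -
    obtain T where T: "\<forall>y\<ge>T. Hb y < 1 / real n"
      using order_tendstoD(2)[OF lim, of "1 / real n"] \<open>n > 0\<close> by (auto simp: eventually_at_top_linorder)
    have "\<exists>y. a \<le> y \<and> y \<le> max T a \<and> Hb y = 1 / real n"
      using T that cont by (intro IVT2) (auto simp: less_imp_le)
    then show ?thesis by auto
  qed
  have ev_level: "eventually (\<lambda>n. 1 / real n \<le> Hb a \<and> n > 0) sequentially"
    using order_tendstoD(2)[OF lim_inverse_n' pos[of a]] eventually_gt_at_top[of 0]
    by eventually_elim auto
  define b where "b n = (if 1 / real n \<le> Hb a \<and> n > 0 then SOME y. y \<ge> a \<and> Hb y = 1 / real n else a)" for n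
  have b_level: "b n \<ge> a \<and> (1 / real n \<le> Hb a \<and> n > 0 \<longrightarrow> Hb (b n) = 1 / real n)" for n
    using someI_ex[OF level] by (auto simp: b_def)
  have "filterlim b at_top sequentially"
  proof (subst filterlim_at_top, intro allI)
    fix Z :: real
    have "eventually (\<lambda>n. 1 / real n < Hb Z) sequentially"
      using order_tendstoD(2)[OF lim_inverse_n' pos[of Z]] .
    with ev_level show "eventually (\<lambda>n. Z \<le> b n) sequentially"
    proof eventually_elim
      case (elim n)
      show ?case
      proof (rule ccontr)
        assume "\<not> Z \<le> b n"
        then have "Hb Z \<le> Hb (b n)" using antimonoD[OF anti, of "b n" Z] by simp
        with elim b_level[of n] show False by simp
      qed
    qed
  qed
  moreover have "eventually (\<lambda>n. Hb (b n) = 1 / real n) sequentially"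
    using ev_level by eventually_elim (use b_level in auto)
  ultimately show thesis using b_level that by blast
qed

lemma MDA_Gumbel_if_von_Mises:
  fixes H h h' :: "real \<Rightarrow> real" and z0 :: real
  assumes mono: "mono H" and less_1: "\<And>y. H y < 1" and lim_1: "(H \<longlongrightarrow> 1) at_top"
    and H_deriv: "\<And>y. y > z0 \<Longrightarrow> (H has_real_derivative h y) (at y)"
    and h_deriv: "\<And>y. y > z0 \<Longrightarrow> (h has_real_derivative h' y) (at y)"
    and h_pos: "\<And>y. y > z0 \<Longrightarrow> h y > 0"
    and von_Mises: "((\<lambda>y. (1 - H y) * h' y / (h y)\<^sup>2) \<longlongrightarrow> -1) at_top"
  shows "MDA Gumbel H"
proof -
  define Hb where "Hb y = 1 - H y" for y
  define G where "G y = Hb y / h y" for y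
  have Hb_pos: "Hb y > 0" for y using less_1[of y] by (simp add: Hb_def)
  have Hb_deriv: "(Hb has_real_derivative - h y) (at y)" if "y > z0" for y
    unfolding Hb_def[abs_def] by (auto intro!: derivative_eq_intros H_deriv[OF that])
  have G_deriv: "(G has_real_derivative -1 - Hb y * h' y / (h y)\<^sup>2) (at y)" if "y > z0" for y
  proof -
    have "(G has_real_derivative (- h y * h y - Hb y * h' y) / (h y * h y)) (at y)"
      unfolding G_def[abs_def] using DERIV_divide[OF Hb_deriv[OF that] h_deriv[OF that]] h_pos[OF that] by simp
    then show ?thesis using h_pos[OF that] by (simp add: field_simps power2_eq_square)
  qed
  have G'_lim: "((\<lambda>y. -1 - Hb y * h' y / (h y)\<^sup>2) \<longlongrightarrow> 0) at_top"
    using tendsto_diff[OF tendsto_const[of "-1"] von_Mises] by (simp add: Hb_def)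
  obtain b where b: "\<And>n. b n \<ge> z0 + 1" "filterlim b at_top sequentially"
    and b_level: "eventually (\<lambda>n. Hb (b n) = 1 / real n) sequentially"
  proof (rule survival_quantile_sequence)
    show "antimono Hb" using mono by (auto simp: Hb_def monotone_def)
    show "(Hb \<longlongrightarrow> 0) at_top" using tendsto_diff[OF tendsto_const[of 1] lim_1] by (simp add: Hb_def[abs_def])
    show "isCont Hb y" if "y \<ge> z0 + 1" for y using Hb_deriv[of y] that DERIV_isCont by auto
  qed (use Hb_pos in auto)
  \<comment> \<open>Normalization: d_n = b n and c_n = G (b n).\<close>
  show ?thesis unfolding MDA_def
  proof (intro exI conjI allI impI)
    show "G (b n) > 0" for n using Hb_pos h_pos[of "b n"] b(1)[of n] by (simp add: G_def)
    fix x :: real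
    have "((\<lambda>y. Hb (y + G y * x) / Hb y) \<longlongrightarrow> exp (- x)) at_top"
      using survival_ratio_tendsto_exp[OF Hb_deriv Hb_pos h_pos _ G'_lim] G_deriv by (simp add: G_def[abs_def])
    from filterlim_compose[OF this b(2)]
    have "(\<lambda>n. real n * Hb (G (b n) * x + b n)) \<longlonglongrightarrow> exp (- x)"
      by (rule Lim_transform_eventually) (use b_level in \<open>eventually_elim, simp add: add.commute\<close>)
    from tendsto_one_minus_power[OF this]
    show "(\<lambda>n. H (G (b n) * x + b n) ^ n) \<longlonglongrightarrow> Gumbel x"
      by (simp add: Hb_def Gumbel_def)
  qed
qed

section \<open>Survival functions near a finite right endpoint\<close>

lemma survival_lower_bound_if_hazard_bounded:
  fixes Fb f :: "real \<Rightarrow> real"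
  assumes "a \<le> x" "c > 0"
    and deriv: "\<And>s. s \<in> {a..x} \<Longrightarrow> (Fb has_real_derivative - f s) (at s)"
    and pos: "\<And>s. s \<in> {a..x} \<Longrightarrow> Fb s > 0"
    and hazard: "\<And>s. s \<in> {a..x} \<Longrightarrow> c * f s \<le> Fb s"
  shows "Fb a * exp (- (x - a) / c) \<le> Fb x"
proof -
  have "ln (Fb a) + a / c \<le> ln (Fb x) + x / c"
  proof (rule DERIV_nonneg_imp_nondecreasing[OF \<open>a \<le> x\<close>])
    fix s assume s: "a \<le> s" "s \<le> x"
    have "0 \<le> - f s / Fb s + 1 / c"
      using hazard[of s] pos[of s] \<open>c > 0\<close> s by (simp add: field_simps)
    moreover have "((\<lambda>s. ln (Fb s) + s / c) has_real_derivative - f s / Fb s + 1 / c) (at s)"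
      using pos[of s] s \<open>c > 0\<close> by (auto intro!: derivative_eq_intros deriv)
    ultimately show "\<exists>y. ((\<lambda>s. ln (Fb s) + s / c) has_real_derivative y) (at s) \<and> 0 \<le> y" by blast
  qed
  then have "ln (Fb a) + - (x - a) / c \<le> ln (Fb x)"
    by (simp add: diff_divide_distrib)
  then have "exp (ln (Fb a) + - (x - a) / c) \<le> exp (ln (Fb x))"
    by (simp only: exp_le_cancel_iff)
  then show ?thesis using pos[of a] pos[of x] \<open>a \<le> x\<close> by (simp add: exp_add)
qed

lemma survival_over_density_tendsto_0:
  fixes Fb f G' :: "real \<Rightarrow> real" and z xF :: real
  assumes "z < xF"
    and Fb_deriv: "\<And>x. x \<in> {z<..<xF} \<Longrightarrow> (Fb has_real_derivative - f x) (at x)"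
    and f_pos: "\<And>x. x \<in> {z<..<xF} \<Longrightarrow> f x > 0"
    and Fb_pos: "\<And>x. x \<in> {z<..<xF} \<Longrightarrow> Fb x > 0"
    and Fb_lim: "(Fb \<longlongrightarrow> 0) (at_left xF)"
    and G_deriv: "\<And>x. x \<in> {z<..<xF} \<Longrightarrow> ((\<lambda>x. Fb x / f x) has_real_derivative G' x) (at x)"
    and G'_lim: "(G' \<longlongrightarrow> 0) (at_left xF)"
  shows "((\<lambda>x. Fb x / f x) \<longlongrightarrow> 0) (at_left xF)"
proof (rule tendstoI)
  fix \<epsilon> :: real assume "\<epsilon> > 0"
  define G where "G x = Fb x / f x" for x
  define e where "e = \<epsilon> / (2 * (xF - z))"
  have "e > 0" using \<open>\<epsilon> > 0\<close> \<open>z < xF\<close> by (simp add: e_def)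
  obtain b where "z < b" "b < xF" and b: "\<And>s. s \<in> {b<..<xF} \<Longrightarrow> \<bar>G' s\<bar> \<le> e"
  proof -
    obtain b0 where "b0 < xF" "\<forall>s>b0. s < xF \<longrightarrow> dist (G' s) 0 < e"
      using tendstoD[OF G'_lim \<open>e > 0\<close>] \<open>z < xF\<close> by (auto simp: eventually_at_left)
    then show thesis by (intro that[of "max b0 ((z + xF) / 2)"]) (use \<open>z < xF\<close> in \<open>auto simp: less_max_iff_disj\<close>)
  qed
  \<comment> \<open>If G were at least \<epsilon> somewhere near xF, it would stay above \<epsilon>/2 up to xF, so Fb would be
    bounded away from 0 there.\<close>
  have G_less: "G x < \<epsilon>" if x: "x \<in> {b<..<xF}" for x
  proof (rule ccontr)
    assume "\<not> G x < \<epsilon>"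
    have Fb_lower: "Fb x * exp (- (xF - x) / (\<epsilon> / 2)) \<le> Fb y" if y: "y \<in> {x..<xF}" for y
    proof -
      have "Fb x * exp (- (xF - x) / (\<epsilon> / 2)) \<le> Fb x * exp (- (y - x) / (\<epsilon> / 2))"
        using y \<open>\<epsilon> > 0\<close> Fb_pos[of x] x \<open>z < b\<close> by (auto simp: field_simps)
      also have "\<dots> \<le> Fb y"
      proof (rule survival_lower_bound_if_hazard_bounded)
        fix s assume s: "s \<in> {x..y}"
        then have s': "s \<in> {z<..<xF}" using x y \<open>z < b\<close> by auto
        show "(Fb has_real_derivative - f s) (at s)" "Fb s > 0" using s' Fb_deriv Fb_pos by auto
        have "\<bar>G s - G x\<bar> \<le> e * \<bar>s - x\<bar>"
          using abs_diff_le_if_deriv_bounded[of x y G G' e s x] s y x b G_deriv \<open>z < b\<close>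
          by (auto simp: G_def[abs_def])
        also have "\<dots> \<le> e * (xF - z)" using s y \<open>e > 0\<close> x \<open>z < b\<close> by (intro mult_left_mono) auto
        also have "\<dots> = \<epsilon> / 2" using \<open>z < xF\<close> by (simp add: e_def field_simps)
        finally have "G s \<ge> \<epsilon> / 2" using \<open>\<not> G x < \<epsilon>\<close> by linarith
        then show "\<epsilon> / 2 * f s \<le> Fb s" using f_pos[OF s'] by (simp add: G_def field_simps)
      qed (use y \<open>\<epsilon> > 0\<close> in auto)
      finally show ?thesis .
    qed
    have K_pos: "Fb x * exp (- (xF - x) / (\<epsilon> / 2)) > 0" using Fb_pos[of x] x \<open>z < b\<close> by simp
    have "x < xF" using x by simp
    with order_tendstoD(2)[OF Fb_lim K_pos] eventually_at_left_real[of x xF]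
    have "eventually (\<lambda>y. Fb y < Fb x * exp (- (xF - x) / (\<epsilon> / 2)) \<and> y \<in> {x<..<xF}) (at_left xF)"
      by (simp add: eventually_conj_iff)
    then have "eventually (\<lambda>y. False) (at_left xF)"
      by eventually_elim (use Fb_lower in \<open>fastforce simp: not_le[symmetric]\<close>)
    then show False by simp
  qed
  have "eventually (\<lambda>x. x \<in> {b<..<xF}) (at_left xF)"
    using eventually_at_left_real[OF \<open>b < xF\<close>] .
  then show "eventually (\<lambda>x. dist (Fb x / f x) 0 < \<epsilon>) (at_left xF)"
  proof eventually_elim
    case (elim x)
    then have "x \<in> {z<..<xF}" using \<open>z < b\<close> by auto
    then show ?case using G_less[OF elim] f_pos[of x] Fb_pos[of x] by (simp add: G_def)
  qed
qed

section \<open>Convexity of products and compositions\<close>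

lemma convex_on_cong:
  assumes "convex_on S f" "\<And>x. x \<in> S \<Longrightarrow> f x = g x"
  shows "convex_on S g"
proof (rule convex_onI)
  show "convex S" using assms(1) by (rule convex_on_imp_convex)
  fix t :: real and x y assume "0 < t" "t < 1" "x \<in> S" "y \<in> S"
  moreover from this \<open>convex S\<close> have "(1 - t) *\<^sub>R x + t *\<^sub>R y \<in> S" by (simp add: convex_def)
  ultimately show "g ((1 - t) *\<^sub>R x + t *\<^sub>R y) \<le> (1 - t) * g x + t * g y"
    using convex_onD[OF assms(1), of t x y] assms(2) by simp
qed

lemma convex_on_mul_antimono:
  fixes S :: "real set"
  assumes "convex_on S f" "convex_on S g" "antimono_on S f" "antimono_on S g"
    and fty: "f \<in> S \<rightarrow> {0..}" and gty: "g \<in> S \<rightarrow> {0..}"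
  shows "convex_on S (\<lambda>x. f x * g x)"
proof (intro convex_on_linorderI)
  show "convex S" using assms convex_on_imp_convex by auto
  fix t :: real and x y
  assume t: "0 < t" "t < 1" and xy: "x \<in> S" "y \<in> S" "x < y"
  have "f y \<le> f x" "g y \<le> g x" using assms(3,4) xy by (auto simp: monotone_on_def)
  then have "0 \<le> t * (1 - t) * ((f x - f y) * (g x - g y))" using t by simp
  then have *: "t*(1-t) * f x * g y + t*(1-t) * f y * g x \<le> t*(1-t) * f x * g x + t*(1-t) * f y * g y"
    by (simp add: algebra_simps)
  have inS: "(1-t)*x + t*y \<in> S" using t xy \<open>convex S\<close> by (simp add: convex_alt)
  then have "f ((1-t)*x + t*y) * g ((1-t)*x + t*y) \<le> ((1-t) * f x + t * f y) * g ((1-t)*x + t*y)"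
    using convex_onD[OF \<open>convex_on S f\<close>, of t x y] t xy fty gty
    by (intro mult_mono add_nonneg_nonneg) (auto simp: Pi_iff zero_le_mult_iff)
  also have "\<dots> \<le> ((1-t) * f x + t * f y) * ((1-t) * g x + t * g y)"
    using convex_onD[OF \<open>convex_on S g\<close>, of t x y] t xy fty gty inS
    by (intro mult_mono add_nonneg_nonneg) (auto simp: Pi_iff zero_le_mult_iff)
  also have "\<dots> \<le> (1-t) * (f x * g x) + t * (f y * g y)"
    using * by (simp add: algebra_simps)
  finally show "f ((1-t) *\<^sub>R x + t *\<^sub>R y) * g ((1-t) *\<^sub>R x + t *\<^sub>R y) \<le> (1-t) * (f x * g x) + t * (f y * g y)"
    by simp
qed

lemma convex_on_antimono_compose_concave:
  fixes f g :: "real \<Rightarrow> real"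
  assumes "convex_on T f" "antimono_on T f" "concave_on S g" "g ` S \<subseteq> T"
  shows "convex_on S (\<lambda>x. f (g x))"
proof (rule convex_onI)
  show "convex S" using assms(3) by (rule concave_on_imp_convex)
  fix t :: real and x y assume t: "0 < t" "t < 1" and xy: "x \<in> S" "y \<in> S"
  have "g x \<in> T" "g y \<in> T" using xy assms(4) by auto
  then have "(1 - t) * g x + t * g y \<in> T"
    using t convex_on_imp_convex[OF assms(1)] by (simp add: convex_alt)
  moreover have "(1 - t) *\<^sub>R x + t *\<^sub>R y \<in> S" using t xy \<open>convex S\<close> by (simp add: convex_def)
  ultimately have "f (g ((1 - t) *\<^sub>R x + t *\<^sub>R y)) \<le> f ((1 - t) * g x + t * g y)"
    using concave_onD[OF assms(3), of t x y] t xy assms(2,4) by (auto simp: monotone_on_def)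
  also have "\<dots> \<le> (1 - t) * f (g x) + t * f (g y)"
    using convex_onD[OF assms(1), of t "g x" "g y"] t xy assms(4) by auto
  finally show "f (g ((1 - t) *\<^sub>R x + t *\<^sub>R y)) \<le> (1 - t) * f (g x) + t * f (g y)" .
qed

section \<open>The reciprocal of the distance to the endpoint\<close>

definition reciprocal_density :: "(real \<Rightarrow> real) \<Rightarrow> real \<Rightarrow> real \<Rightarrow> real" where
  "reciprocal_density f c y = (if 0 < y then f (c - 1 / y) / y\<^sup>2 else 0)"

lemma borel_measurable_reciprocal_density [measurable]:
  assumes [measurable]: "f \<in> borel_measurable borel"
  shows "reciprocal_density f c \<in> borel_measurable borel"
  unfolding reciprocal_density_def[abs_def] by measurable

lemma nn_integral_indicator_Union_incseq:
  fixes g :: "'a \<Rightarrow> ennreal"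
  assumes [measurable]: "g \<in> borel_measurable M" and "incseq A" "\<And>n. A n \<in> sets M"
  shows "(\<integral>\<^sup>+x. g x * indicator (\<Union>n. A n) x \<partial>M) = (SUP n. \<integral>\<^sup>+x. g x * indicator (A n) x \<partial>M)"
  using SUP_emeasure_incseq[of A "density M g"] assms by (simp add: emeasure_density image_subset_iff)

lemma nn_integral_reciprocal_substitution:
  fixes g :: "real \<Rightarrow> ennreal" and c :: real
  assumes [measurable]: "g \<in> borel_measurable borel"
  shows "(\<integral>\<^sup>+x. g x * indicator {..<c} x \<partial>lborel)
       = (\<integral>\<^sup>+y. g (c - 1 / y) * ennreal (1 / y\<^sup>2) * indicator {0<..} y \<partial>lborel)"
proof -
  define a where "a n = 1 / (real n + 2)" for n :: nat
  define b where "b n = real n + 2" for n :: nat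
  have ab: "0 < a n" "a n < b n" for n
  proof -
    have "a n < 1" "1 < b n" by (simp_all add: a_def b_def divide_less_eq)
    then show "0 < a n" "a n < b n" by (simp add: a_def, linarith)
  qed
  have "incseq (\<lambda>n. {a n..b n})"
    by (auto simp: incseq_def a_def b_def intro: order_trans[rotated] frac_le)
  moreover have "(\<Union>n. {a n..b n}) = {0<..}"
  proof (intro equalityI subsetI)
    fix y :: real assume "y \<in> {0<..}"
    then have "y > 0" by simp
    obtain n :: nat where n: "real n > max y (1 / y)" using reals_Archimedean2 by blast
    then have "a n \<le> y" using frac_le[of 1 1 "1 / y" "real n + 2"] \<open>y > 0\<close> by (auto simp: a_def)
    with n show "y \<in> (\<Union>n. {a n..b n})" by (auto simp: b_def)
  qed (use ab in \<open>force intro: less_le_trans\<close>)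
  ultimately have J: "(\<integral>\<^sup>+y. g (c - 1 / y) * ennreal (1 / y\<^sup>2) * indicator {0<..} y \<partial>lborel)
      = (SUP n. \<integral>\<^sup>+y. g (c - 1 / y) * ennreal (1 / y\<^sup>2) * indicator {a n..b n} y \<partial>lborel)"
    using nn_integral_indicator_Union_incseq[of "\<lambda>y. g (c - 1 / y) * ennreal (1 / y\<^sup>2)" lborel "\<lambda>n. {a n..b n}"]
    by simp
  have "incseq (\<lambda>n. {c - 1 / a n..c - 1 / b n})"
    by (auto simp: incseq_def a_def b_def intro: order_trans[rotated] frac_le)
  moreover have "(\<Union>n. {c - 1 / a n..c - 1 / b n}) = {..<c}"
  proof (intro equalityI subsetI)
    fix x assume "x \<in> {..<c}"
    then have "c - x > 0" by simp
    obtain n :: nat where n: "real n > max (c - x) (1 / (c - x))" using reals_Archimedean2 by blast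
    then have "c - 1 / a n \<le> x" by (simp add: a_def)
    moreover have "1 / b n \<le> c - x"
      using frac_le[of 1 1 "1 / (c - x)" "real n + 2"] n \<open>c - x > 0\<close> by (auto simp: b_def)
    ultimately show "x \<in> (\<Union>n. {c - 1 / a n..c - 1 / b n})" by auto
  next
    fix x assume "x \<in> (\<Union>n. {c - 1 / a n..c - 1 / b n})"
    then obtain n where "x \<le> c - 1 / b n" by auto
    then show "x \<in> {..<c}" by (simp add: b_def) (smt (verit) divide_pos_pos of_nat_0_le_iff)
  qed
  ultimately have I: "(\<integral>\<^sup>+x. g x * indicator {..<c} x \<partial>lborel)
      = (SUP n. \<integral>\<^sup>+x. g x * indicator {c - 1 / a n..c - 1 / b n} x \<partial>lborel)"
    using nn_integral_indicator_Union_incseq[of g lborel "\<lambda>n. {c - 1 / a n..c - 1 / b n}"] by simp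
  have "(\<integral>\<^sup>+x. g x * indicator {c - 1 / a n..c - 1 / b n} x \<partial>lborel)
      = (\<integral>\<^sup>+y. g (c - 1 / y) * ennreal (1 / y\<^sup>2) * indicator {a n..b n} y \<partial>lborel)" for n
    using ab[of n]
    by (intro nn_integral_substitution_aux[where g = "\<lambda>y. c - 1 / y"])
       (auto intro!: derivative_eq_intros continuous_intros simp: power2_eq_square)
  then show ?thesis unfolding I J by simp
qed

lemma distr_density_reciprocal:
  fixes f :: "real \<Rightarrow> real" and c :: real
  assumes [measurable]: "f \<in> borel_measurable borel" and nonneg: "\<And>x. f x \<ge> 0"
    and null: "emeasure (density lborel f) {c..} = 0"
  shows "distr (density lborel f) lborel (\<lambda>x. 1 / (c - x)) = density lborel (reciprocal_density f c)"
proof (rule measure_eqI)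
  fix A assume "A \<in> sets (distr (density lborel f) lborel (\<lambda>x. 1 / (c - x)))"
  then have [measurable]: "A \<in> sets borel" by simp
  have "(\<integral>\<^sup>+x. ennreal (f x) * indicator {c..} x \<partial>lborel) = 0"
    using null by (simp add: emeasure_density)
  then have "AE x in lborel. ennreal (f x) * indicator {c..} x = 0"
    by (simp add: nn_integral_0_iff_AE)
  then have "(\<integral>\<^sup>+x. ennreal (f x) * indicator A (1 / (c - x)) \<partial>lborel)
      = (\<integral>\<^sup>+x. ennreal (f x) * indicator A (1 / (c - x)) * indicator {..<c} x \<partial>lborel)"
    by (auto simp: indicator_def intro!: nn_integral_cong_AE elim!: AE_mp)
  moreover have "emeasure (distr (density lborel f) lborel (\<lambda>x. 1 / (c - x))) A
      = (\<integral>\<^sup>+x. ennreal (f x) * indicator A (1 / (c - x)) \<partial>lborel)"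
    using measurable_sets[of "\<lambda>x::real. 1 / (c - x)" borel borel A]
    by (subst emeasure_distr, simp, simp, subst emeasure_density) (auto simp: indicator_def)
  ultimately have "emeasure (distr (density lborel f) lborel (\<lambda>x. 1 / (c - x))) A
      = (\<integral>\<^sup>+x. ennreal (f x) * indicator A (1 / (c - x)) * indicator {..<c} x \<partial>lborel)"
    by simp
  also have "\<dots> = (\<integral>\<^sup>+y. ennreal (reciprocal_density f c y) * indicator A y \<partial>lborel)"
    by (subst nn_integral_reciprocal_substitution)
       (auto intro!: nn_integral_cong simp: reciprocal_density_def indicator_def ennreal_mult[symmetric] nonneg divide_inverse)
  also have "\<dots> = emeasure (density lborel (reciprocal_density f c)) A"
    by (simp add: emeasure_density image_subset_iff)
  finally show "emeasure (distr (density lborel f) lborel (\<lambda>x. 1 / (c - x))) A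
      = emeasure (density lborel (reciprocal_density f c)) A" .
qed simp

lemma reciprocal_distance_le_iff:
  fixes c x y :: real
  assumes "y > 0"
  shows "1 / (c - x) \<le> y \<longleftrightarrow> x \<le> c - 1 / y \<or> c \<le> x"
proof (cases "x < c")
  case True
  then have "1 / (c - x) \<le> y \<longleftrightarrow> 1 / y \<le> c - x"
    using assms by (simp add: divide_le_eq mult.commute)
  with True show ?thesis by auto
next
  case False
  then show ?thesis using assms by (simp add: divide_nonpos_pos order.trans[of _ 0 y])
qed

locale reciprocal_distance = prob_space M for M :: "'a measure" +
  fixes X :: "'a \<Rightarrow> real" and f :: "real \<Rightarrow> real" and xF :: real
  assumes X_density: "distributed M lborel X (\<lambda>x. ennreal (f x))"
    and f_nonneg: "\<And>x. f x \<ge> 0"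
    and right_endpoint_X: "right_endpoint (cdf (distr M borel X)) = ereal xF"
begin

abbreviation "F \<equiv> cdf (distr M borel X)"
abbreviation "Y \<equiv> \<lambda>\<omega>. 1 / (xF - X \<omega>)"
abbreviation "FY \<equiv> cdf (distr M borel Y)"
abbreviation "fY \<equiv> reciprocal_density f xF"

lemma measurable_X [measurable]: "X \<in> borel_measurable M"
  using distributed_measurable[OF X_density] by simp

lemma measurable_f [measurable]: "f \<in> borel_measurable borel"
  using distributed_real_measurable[OF _ X_density] f_nonneg by simp

sublocale X: real_distribution "distr M borel X" by simp

sublocale Y: real_distribution "distr M borel Y" by simp

lemma distr_X_eq_density: "distr M borel X = density lborel f"
proof -
  have "distr M borel X = distr M lborel X" by (rule distr_cong) auto
  then show ?thesis using distributed_distr_eq_density[OF X_density] by simp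
qed

lemma F_less_1:
  assumes "x < xF" shows "F x < 1"
proof -
  have "ereal x < Sup (ereal ` {x. F x < 1})"
    using assms right_endpoint_X by (simp add: right_endpoint_def)
  then obtain u where "F u < 1" "x < u" by (auto simp: less_Sup_iff)
  then show ?thesis using X.cdf_nondecreasing[of x u] by simp
qed

lemma F_eq_1:
  assumes "xF \<le> x" shows "F x = 1"
proof -
  have beyond: "F u = 1" if "xF < u" for u
  proof (rule ccontr)
    assume "F u \<noteq> 1"
    then have "ereal u \<le> Sup (ereal ` {x. F x < 1})"
      using X.cdf_bounded_prob[of u] by (intro Sup_upper) auto
    then show False using right_endpoint_X that by (simp add: right_endpoint_def)
  qed
  have "(F \<longlongrightarrow> F x) (at_right x)"
    using X.cdf_is_right_cont[of x] by (simp add: continuous_within)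
  moreover have "eventually (\<lambda>y. F y = 1) (at_right x)"
    using eventually_at_right_less[of x] by eventually_elim (use assms beyond in simp)
  ultimately have "((\<lambda>_. 1) \<longlongrightarrow> F x) (at_right x)"
    by (rule Lim_transform_eventually)
  from tendsto_unique[OF trivial_limit_at_right_real this tendsto_const] show ?thesis by simp
qed

lemma isCont_F: "isCont F x"
proof -
  have "emeasure (density lborel f) {x} = 0"
    by (subst emeasure_density) (auto intro: nn_integral_null_set)
  then show ?thesis unfolding X.isCont_cdf by (simp add: distr_X_eq_density measure_def)
qed

lemma emeasure_density_ge_endpoint: "emeasure (density lborel f) {xF..} = 0"
proof -
  have "(F \<longlongrightarrow> 1) (at_left xF)"
    using isCont_F[of xF] F_eq_1[of xF] by (simp add: isCont_def filterlim_at_split)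
  from tendsto_unique[OF trivial_limit_at_left_real X.cdf_at_left this]
  have "measure (distr M borel X) {..<xF} = 1" .
  moreover have "measure (distr M borel X) {xF..} = 1 - measure (distr M borel X) {..<xF}"
    using X.prob_compl[of "{..<xF}"] by (simp add: Compl_eq_Diff_UNIV[symmetric] not_less atLeast_def)
  ultimately show ?thesis
    by (simp add: X.emeasure_eq_measure flip: distr_X_eq_density)
qed

lemma distributed_Y: "distributed M lborel Y fY"
proof -
  have "distr M lborel Y = distr (distr M lborel X) lborel (\<lambda>x. 1 / (xF - x))"
    by (subst distr_distr) (auto simp: comp_def)
  also have "\<dots> = density lborel fY"
    using distributed_distr_eq_density[OF X_density] f_nonneg emeasure_density_ge_endpoint
    by (simp add: distr_density_reciprocal)
  finally show ?thesis by (simp add: distributed_def)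
qed

lemma FY_pos:
  assumes "y > 0" shows "FY y = F (xF - 1 / y)"
proof -
  have "Y -` {..y} \<inter> space M = X -` ({..xF - 1 / y} \<union> {xF..}) \<inter> space M"
    using reciprocal_distance_le_iff[OF assms] by auto
  then have "FY y = measure (distr M borel X) ({..xF - 1 / y} \<union> {xF..})"
    by (simp add: cdf_def measure_distr)
  also have "\<dots> = F (xF - 1 / y)"
    using emeasure_density_ge_endpoint
    by (simp add: measure_Un_null_set null_sets_def cdf_def distr_X_eq_density)
  finally show ?thesis .
qed

lemma FY_nonpos:
  assumes "y \<le> 0" shows "FY y = 0"
proof -
  have "xF \<le> X \<omega>" if "Y \<omega> \<le> y" for \<omega>
    using order_trans[OF that assms] by simp
  then have "FY y \<le> measure (distr M borel X) {xF..}"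
    unfolding cdf_def by (simp add: measure_distr) (auto intro!: finite_measure_mono)
  then show ?thesis
    using emeasure_density_ge_endpoint Y.cdf_nonneg[of y] by (simp add: measure_def distr_X_eq_density)
qed

lemma FY_less_1: "FY y < 1"
  using FY_pos F_less_1[of "xF - 1 / y"] FY_nonpos[of y] by (cases "y > 0") auto

lemma right_endpoint_Y: "right_endpoint FY = \<infinity>"
proof -
  have "{y. FY y < 1} = UNIV" using FY_less_1 by auto
  then show ?thesis unfolding right_endpoint_def by (auto intro!: SUP_PInfty simp del: range_ereal)
qed

end

locale reciprocal_distance_regular = reciprocal_distance +
  fixes z :: real
  assumes z_less: "z < xF"
    and F_deriv: "\<And>x. x \<in> {z<..<xF} \<Longrightarrow> (F has_real_derivative f x) (at x)"
    and f_differentiable: "\<And>x. x \<in> {z<..<xF} \<Longrightarrow> f differentiable (at x)"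
    and f_pos: "\<And>x. x \<in> {z<..<xF} \<Longrightarrow> f x > 0"
    and f_antimono: "antimono_on {z<..<xF} f"
    and f_convex: "convex_on {z<..<xF} f"
begin

definition zY :: real where "zY = 1 / (xF - z)"

lemma zY_pos: "zY > 0"
  using z_less by (simp add: zY_def)

lemma xF_minus_inverse_mem:
  assumes "y > zY" shows "xF - 1 / y \<in> {z<..<xF}"
proof -
  have "y > 0" using assms zY_pos by linarith
  moreover have "1 / y < 1 / zY" using assms zY_pos by (simp add: frac_less2)
  ultimately show ?thesis by (simp add: zY_def)
qed

lemma f_deriv: "x \<in> {z<..<xF} \<Longrightarrow> (f has_real_derivative deriv f x) (at x)"
  using f_differentiable DERIV_deriv_iff_real_differentiable by blast

lemma fY_eq: "y > 0 \<Longrightarrow> fY y = f (xF - 1 / y) / y\<^sup>2"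
  by (simp add: reciprocal_density_def)

lemma xF_minus_inverse_deriv: "y > 0 \<Longrightarrow> ((\<lambda>y. xF - 1 / y) has_real_derivative 1 / y\<^sup>2) (at y)"
  by (auto intro!: derivative_eq_intros simp: power2_eq_square)

lemma FY_deriv:
  assumes "y > zY" shows "(FY has_real_derivative fY y) (at y)"
proof -
  have "y > 0" using assms zY_pos by linarith
  have "((\<lambda>y. F (xF - 1 / y)) has_real_derivative f (xF - 1 / y) * (1 / y\<^sup>2)) (at y)"
    by (rule DERIV_chain2[OF F_deriv[OF xF_minus_inverse_mem[OF assms]] xF_minus_inverse_deriv[OF \<open>y > 0\<close>]])
  then have "((\<lambda>y. F (xF - 1 / y)) has_real_derivative fY y) (at y)"
    using \<open>y > 0\<close> by (simp add: fY_eq)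
  then show ?thesis
    by (rule has_field_derivative_transform_within_open[where S = "{0<..}"])
       (use \<open>y > 0\<close> FY_pos fY_eq in auto)
qed

lemma fY_deriv:
  assumes "y > zY"
  shows "(fY has_real_derivative deriv f (xF - 1 / y) / y ^ 4 - 2 * f (xF - 1 / y) / y ^ 3) (at y)"
proof -
  have "y > 0" using assms zY_pos by linarith
  have "((\<lambda>y. f (xF - 1 / y)) has_real_derivative deriv f (xF - 1 / y) * (1 / y\<^sup>2)) (at y)"
    by (rule DERIV_chain2[OF f_deriv[OF xF_minus_inverse_mem[OF assms]] xF_minus_inverse_deriv[OF \<open>y > 0\<close>]])
  from DERIV_divide[OF this DERIV_power[OF DERIV_ident, of 2 y]] \<open>y > 0\<close>
  have "((\<lambda>y. f (xF - 1 / y) / y\<^sup>2) has_real_derivative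
      deriv f (xF - 1 / y) / y ^ 4 - 2 * f (xF - 1 / y) / y ^ 3) (at y)"
    by (simp add: field_simps power2_eq_square power3_eq_cube power4_eq_xxxx)
  then show ?thesis
    by (rule has_field_derivative_transform_within_open[where S = "{0<..}"])
       (use \<open>y > 0\<close> fY_eq in auto)
qed

lemma fY_pos: "y > zY \<Longrightarrow> fY y > 0"
  using f_pos[OF xF_minus_inverse_mem] zY_pos by (simp add: reciprocal_density_def)

lemma antimono_f_xF_minus_inverse: "antimono_on {zY<..} (\<lambda>y. f (xF - 1 / y))"
proof (rule monotone_onI)
  fix a b assume ab: "a \<in> {zY<..}" "b \<in> {zY<..}" "a \<le> b"
  then have "xF - 1 / a \<le> xF - 1 / b" using zY_pos by (simp add: frac_le)
  then show "f (xF - 1 / b) \<le> f (xF - 1 / a)"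
    using monotone_onD[OF f_antimono xF_minus_inverse_mem xF_minus_inverse_mem] ab by auto
qed

lemma antimono_fY: "antimono_on {zY<..} fY"
proof (rule monotone_onI)
  fix a b assume ab: "a \<in> {zY<..}" "b \<in> {zY<..}" "a \<le> b"
  then have "a > 0" using zY_pos by auto
  have "f (xF - 1 / b) / b\<^sup>2 \<le> f (xF - 1 / a) / b\<^sup>2"
    using monotone_onD[OF antimono_f_xF_minus_inverse ab] by (simp add: divide_right_mono)
  also have "\<dots> \<le> f (xF - 1 / a) / a\<^sup>2"
    using ab \<open>a > 0\<close> f_nonneg by (intro divide_left_mono power_mono) auto
  finally show "fY b \<le> fY a" using ab \<open>a > 0\<close> by (simp add: fY_eq)
qed

lemma convex_fY: "convex_on {zY<..} fY"
proof -
  have cinv: "convex_on {zY<..} inverse"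
    using zY_pos by (intro convex_on_inverse) auto
  have ainv: "antimono_on {zY<..} (inverse :: real \<Rightarrow> real)"
    using zY_pos by (intro monotone_onI) (auto intro: le_imp_inverse_le)
  have cinv2: "convex_on {zY<..} (\<lambda>y. inverse y * inverse y)"
    using zY_pos by (intro convex_on_mul_antimono[OF cinv cinv ainv ainv]) auto
  have ainv2: "antimono_on {zY<..} (\<lambda>y. inverse y * inverse y)"
    using zY_pos by (intro monotone_onI) (auto intro!: mult_mono le_imp_inverse_le)
  have "convex_on {zY<..} (\<lambda>y. inverse y + - xF)"
    by (intro convex_on_add cinv) (simp add: convex_on_const)
  then have "concave_on {zY<..} (\<lambda>y. xF - 1 / y)"
    unfolding concave_on_def by (rule convex_on_cong) (simp add: inverse_eq_divide)
  then have "convex_on {zY<..} (\<lambda>y. f (xF - 1 / y))"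
    using xF_minus_inverse_mem by (intro convex_on_antimono_compose_concave[OF f_convex f_antimono]) auto
  then have "convex_on {zY<..} (\<lambda>y. f (xF - 1 / y) * (inverse y * inverse y))"
    using f_nonneg zY_pos by (intro convex_on_mul_antimono[OF _ cinv2 antimono_f_xF_minus_inverse ainv2]) auto
  then show ?thesis
    by (rule convex_on_cong) (use zY_pos in \<open>auto simp: fY_eq power2_eq_square divide_inverse\<close>)
qed

lemma survival_over_distance_density_tendsto_0:
  assumes von_Mises: "((\<lambda>x. (1 - F x) * deriv f x / (f x)\<^sup>2) \<longlongrightarrow> -1) (at_left xF)"
  shows "((\<lambda>x. (1 - F x) / ((xF - x) * f x)) \<longlongrightarrow> 0) (at_left xF)"
proof -
  define G' where "G' x = -1 - (1 - F x) * deriv f x / (f x)\<^sup>2" for x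
  have G'_lim: "(G' \<longlongrightarrow> 0) (at_left xF)"
    using tendsto_diff[OF tendsto_const[of "-1"] von_Mises] by (simp add: G'_def[abs_def])
  have survival_deriv: "((\<lambda>x. 1 - F x) has_real_derivative - f x) (at x)" if "x \<in> {z<..<xF}" for x
    by (auto intro!: derivative_eq_intros F_deriv that)
  have G_deriv: "((\<lambda>x. (1 - F x) / f x) has_real_derivative G' x) (at x)" if "x \<in> {z<..<xF}" for x
    using DERIV_divide[OF survival_deriv[OF that] f_deriv[OF that]] f_pos[OF that]
    by (simp add: G'_def field_simps power2_eq_square)
  have at_left: "eventually (\<lambda>x. x \<in> {z<..<xF}) (at_left xF)"
    using eventually_at_left_real[OF z_less] .
  have "((\<lambda>x. (1 - F x) / f x) \<longlongrightarrow> 0) (at_left xF)"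
  proof (rule survival_over_density_tendsto_0[OF z_less survival_deriv f_pos _ _ G_deriv G'_lim])
    show "1 - F x > 0" if "x \<in> {z<..<xF}" for x using F_less_1 that by simp
    show "((\<lambda>x. 1 - F x) \<longlongrightarrow> 0) (at_left xF)"
      using isCont_F[of xF] F_eq_1[of xF] tendsto_diff[OF tendsto_const[of 1], of F 1 "at_left xF"]
      by (simp add: isCont_def filterlim_at_split)
  qed
  moreover have "((\<lambda>x. xF - x) \<longlongrightarrow> 0) (at_left xF)"
    by (rule tendsto_eq_intros refl)+ simp
  moreover have "eventually (\<lambda>x. xF - x \<noteq> 0) (at_left xF)"
    using at_left by eventually_elim simp
  moreover have "eventually (\<lambda>x. (-1 :: real) \<noteq> 0) (at_left xF)" by simp
  moreover have "eventually (\<lambda>x. ((\<lambda>x. (1 - F x) / f x) has_real_derivative G' x) (at x)) (at_left xF)"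
    using at_left by eventually_elim (rule G_deriv)
  moreover have "eventually (\<lambda>x. ((\<lambda>x. xF - x) has_real_derivative -1) (at x)) (at_left xF)"
    by (intro always_eventually allI) (auto intro!: derivative_eq_intros)
  moreover have "((\<lambda>x. G' x / -1) \<longlongrightarrow> 0) (at_left xF)"
    using tendsto_minus[OF G'_lim] by simp
  ultimately have "((\<lambda>x. (1 - F x) / f x / (xF - x)) \<longlongrightarrow> 0) (at_left xF)"
    by (rule lhopital_left)
  then show ?thesis by (simp add: mult.commute)
qed

lemma deriv_fY:
  "y > zY \<Longrightarrow> deriv fY y = deriv f (xF - 1 / y) / y ^ 4 - 2 * f (xF - 1 / y) / y ^ 3"
  by (rule DERIV_imp_deriv[OF fY_deriv])

lemma von_Mises_Y:
  assumes von_Mises: "((\<lambda>x. (1 - F x) * deriv f x / (f x)\<^sup>2) \<longlongrightarrow> -1) (at_left xF)"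
  shows "((\<lambda>y. (1 - FY y) * deriv fY y / (fY y)\<^sup>2) \<longlongrightarrow> -1) at_top"
proof -
  have "((\<lambda>x. (1 - F x) * deriv f x / (f x)\<^sup>2 - 2 * ((1 - F x) / ((xF - x) * f x))) \<longlongrightarrow> -1)
      (at_left xF)"
    using tendsto_diff[OF von_Mises tendsto_mult[OF tendsto_const survival_over_distance_density_tendsto_0[OF von_Mises]], of 2]
    by simp
  moreover have "filterlim (\<lambda>y. xF - 1 / y) (at_left xF) at_top"
    unfolding filterlim_at
  proof
    show "((\<lambda>y. xF - 1 / y) \<longlongrightarrow> xF) at_top" by real_asymp
    show "eventually (\<lambda>y. xF - 1 / y \<in> {..<xF} \<and> xF - 1 / y \<noteq> xF) at_top"
      using eventually_gt_at_top[of 0] by eventually_elim auto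
  qed
  ultimately have "((\<lambda>y. (1 - F (xF - 1 / y)) * deriv f (xF - 1 / y) / (f (xF - 1 / y))\<^sup>2
      - 2 * ((1 - F (xF - 1 / y)) / ((xF - (xF - 1 / y)) * f (xF - 1 / y)))) \<longlongrightarrow> -1) at_top"
    by (rule filterlim_compose)
  moreover have "eventually (\<lambda>y. (1 - F (xF - 1 / y)) * deriv f (xF - 1 / y) / (f (xF - 1 / y))\<^sup>2
      - 2 * ((1 - F (xF - 1 / y)) / ((xF - (xF - 1 / y)) * f (xF - 1 / y)))
      = (1 - FY y) * deriv fY y / (fY y)\<^sup>2) at_top"
    using eventually_gt_at_top[of zY]
  proof eventually_elim
    case (elim y)
    then have "y > 0" "f (xF - 1 / y) > 0" using zY_pos f_pos[OF xF_minus_inverse_mem] by auto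
    then show ?case using elim
      by (simp add: FY_pos fY_eq deriv_fY field_simps power2_eq_square power3_eq_cube power4_eq_xxxx)
  qed
  ultimately show ?thesis by (rule Lim_transform_eventually)
qed

lemma MDA_Gumbel_Y:
  assumes "((\<lambda>x. (1 - F x) * deriv f x / (f x)\<^sup>2) \<longlongrightarrow> -1) (at_left xF)"
  shows "MDA Gumbel FY"
proof (rule MDA_Gumbel_if_von_Mises[OF _ FY_less_1 Y.cdf_lim_at_top_prob FY_deriv _ fY_pos von_Mises_Y[OF assms]])
  show "mono FY" by (rule monoI) (rule Y.cdf_nondecreasing)
  show "(fY has_real_derivative deriv fY y) (at y)" if "y > zY" for y
    using fY_deriv[OF that] deriv_fY[OF that] by simp
qed

end

theorem proposition3:
  fixes M :: "'a measure" and X :: "'a \<Rightarrow> real" and f :: "real \<Rightarrow> real" and xF :: real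
  assumes prob: "prob_space M"
    and dens: "distributed M lborel X (\<lambda>x. ennreal (f x))"
    and fnonneg: "\<And>x. f x \<ge> 0"
    and xF: "right_endpoint (cdf (distr M borel X)) = ereal xF"
    and A1: "\<exists>z < xF. (\<forall>x\<in>{z<..<xF}.
                 (cdf (distr M borel X) has_real_derivative f x) (at x) \<and>
                 f differentiable (at x) \<and> f x > 0) \<and>
               antimono_on {z<..<xF} f \<and> convex_on {z<..<xF} f"
    and MDA: "MDA Gumbel (cdf (distr M borel X))"
    and A3: "((\<lambda>x. (1 - cdf (distr M borel X) x) * deriv f x / (f x)\<^sup>2) \<longlongrightarrow> -1) (at_left xF)"
  shows "\<exists>fY :: real \<Rightarrow> real. \<exists>zY :: real.
           distributed M lborel (\<lambda>\<omega>. 1 / (xF - X \<omega>)) (\<lambda>y. ennreal (fY y)) \<and>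
           (\<forall>y. fY y \<ge> 0) \<and>
           (\<forall>y\<in>{zY<..}. (cdf (distr M borel (\<lambda>\<omega>. 1 / (xF - X \<omega>))) has_real_derivative fY y) (at y) \<and>
                 fY differentiable (at y) \<and> fY y > 0) \<and>
           antimono_on {zY<..} fY \<and> convex_on {zY<..} fY \<and>
           MDA Gumbel (cdf (distr M borel (\<lambda>\<omega>. 1 / (xF - X \<omega>)))) \<and>
           right_endpoint (cdf (distr M borel (\<lambda>\<omega>. 1 / (xF - X \<omega>)))) = \<infinity> \<and>
           ((\<lambda>y. (1 - cdf (distr M borel (\<lambda>\<omega>. 1 / (xF - X \<omega>))) y) * deriv fY y / (fY y)\<^sup>2)
              \<longlongrightarrow> -1) at_top"
proof -
  obtain z where regular: "z < xF"
    "\<And>x. x \<in> {z<..<xF} \<Longrightarrow> (cdf (distr M borel X) has_real_derivative f x) (at x)"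
    "\<And>x. x \<in> {z<..<xF} \<Longrightarrow> f differentiable (at x)"
    "\<And>x. x \<in> {z<..<xF} \<Longrightarrow> f x > 0"
    "antimono_on {z<..<xF} f" "convex_on {z<..<xF} f"
    using A1 by blast
  interpret reciprocal_distance_regular M X f xF z
    by (intro reciprocal_distance_regular.intro reciprocal_distance.intro
        reciprocal_distance_regular_axioms.intro reciprocal_distance_axioms.intro prob dens fnonneg xF regular)
  have "\<forall>y. fY y \<ge> 0"
    using fnonneg by (simp add: reciprocal_density_def)
  moreover have "\<forall>y\<in>{zY<..}. (FY has_real_derivative fY y) (at y) \<and> fY differentiable (at y) \<and> fY y > 0"
    using FY_deriv fY_deriv fY_pos by (auto simp: real_differentiable_def)
  ultimately show ?thesis
    using distributed_Y antimono_fY convex_fY MDA_Gumbel_Y[OF A3] right_endpoint_Y von_Mises_Y[OF A3]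
    by blast
qed

end
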